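(* Let $d\ge 2$, $e\ge 1$, $n\ge 1$ be integers, and suppose that $[n]$ is the disjoint union of sets $X_1,\ldots,X_e$. Let $\mathcal{D}= \{(A_i^{(1)},\dots,A_i^{(d)})\}_{1\le i\le m}$ be a symmetric Bollobás system of $d$-partitions of $[n]$. Let $s_k=\left|X_k\cap \left(\bigcup_{i=1}^m\bigcup_{r=1}^d A_i^{(r)}\right)\right|$ for $k\in[e]$. Then $$\sum_{i=1}^{m}\left(\prod_{k=1}^{e}\binom{\sum_{r=1}^{d}|A_i^{(r)}\cap X_k| }{|A_i^{(1)}\cap X_k|,\dots,|A_i^{(d)}\cap X_k|}\right)^{-1}\le \min_{l\in [e]}\frac{ \prod_{k=1}^{e}\binom{s_k+d-1}{d-1}}{\binom{s_l+d-1}{d-1}}.$$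
   Context: For a positive integer $n$, $[n]=\{1,\dots,n\}$. For $d\ge 2$, a $d$-partition of $[n]$ is a tuple $(A^{(1)},\dots,A^{(d)})$ of (possibly empty) pairwise disjoint subsets of $[n]$; their union need not be all of $[n]$. A family $\{(A_i^{(1)},\dots,A_i^{(d)})\}_{1\le i\le m}$ of $d$-partitions of $[n]$ is a symmetric Bollobás system if for any $1\le i<j\le m$ there exist $1\le p<q\le d$ such that $A_i^{(p)}\cap A_j^{(q)}\ne\emptyset$ and $A_j^{(p)}\cap A_i^{(q)}\ne\emptyset$. For non-negative integers $a_1,\ldots,a_d$ with $a_1+\cdots+a_d\le N$, $\binom{N}{a_1,\ldots,a_d}=\frac{N!}{a_1!\cdots a_d!(N-a_1-\cdots-a_d)!}$. *)

theory Defs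
  imports Complex_Main "HOL-Library.Disjoint_Sets"
begin

text \<open>
  Tuples \<open>(A^(1), ..., A^(d))\<close> are functions on \<open>nat\<close> of which only the values
  at the indices \<open>{1..d}\<close> matter; likewise a family of \<open>m\<close> tuples is a function
  of which only the values at \<open>{1..m}\<close> matter.
\<close>

definition d_partition :: "nat \<Rightarrow> nat \<Rightarrow> (nat \<Rightarrow> nat set) \<Rightarrow> bool" where
  "d_partition d n A \<longleftrightarrow>
     (\<forall>r\<in>{1..d}. A r \<subseteq> {1..n}) \<and> disjoint_family_on A {1..d}"

definition symmetric_bollobas_system ::
    "nat \<Rightarrow> nat \<Rightarrow> nat \<Rightarrow> (nat \<Rightarrow> nat \<Rightarrow> nat set) \<Rightarrow> bool" where
  "symmetric_bollobas_system d n m A \<longleftrightarrow>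
     (\<forall>i\<in>{1..m}. d_partition d n (A i)) \<and>
     (\<forall>i j. 1 \<le> i \<and> i < j \<and> j \<le> m \<longrightarrow>
        (\<exists>p q. 1 \<le> p \<and> p < q \<and> q \<le> d \<and>
           A i p \<inter> A j q \<noteq> {} \<and> A j p \<inter> A i q \<noteq> {}))"

text \<open>
  The multinomial coefficient is meaningful only if \<open>(\<Sum>r=1..d. a r) \<le> N\<close>;
  otherwise the truncated subtraction gives a junk value.
\<close>

definition multinomial :: "nat \<Rightarrow> nat \<Rightarrow> (nat \<Rightarrow> nat) \<Rightarrow> real" where
  "multinomial d N a =
     fact N / ((\<Prod>r=1..d. fact (a r)) * fact (N - (\<Sum>r=1..d. a r)))"

end

theory Submission
  imports Defs "HOL-Combinatorics.Multiset_Permutations" "HOL-Library.FuncSet"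
begin

text \<open>
  The argument is a random-order argument in the style of Lubell's proof of the LYM inequality.
  Write \<open>S\<^sub>k\<close> for the part of \<open>X\<^sub>k\<close> covered by the system and order every \<open>S\<^sub>k\<close> uniformly at
  random, independently for different \<open>k\<close>. Let \<open>E\<^sub>i\<close> be the event that in every one of these
  orders the elements of the blocks of the \<open>i\<close>-th member occur block by block: those of
  \<open>A\<^sub>i\<^bsup>(1)\<^esup>\<close> first, then those of \<open>A\<^sub>i\<^bsup>(2)\<^esup>\<close>, and so on, with all other elements anywhere. The
  probability of \<open>E\<^sub>i\<close> is exactly the \<open>i\<close>-th summand of the inequality, because the orders are
  independent and a single order contributes the inverse of a multinomial coefficient
  (lemma \<open>card_block_ordered_permutations\<close>). The left-hand side is therefore the expected
  number of events that occur, and it suffices to bound this number for every outcome.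

  Fix an outcome and an index \<open>l\<close>. If \<open>E\<^sub>i\<close> occurs, then for each \<open>k \<noteq> l\<close> the list of \<open>S\<^sub>k\<close> can be
  cut into \<open>d\<close> consecutive, possibly empty, intervals such that the \<open>p\<close>-th interval contains
  \<open>A\<^sub>i\<^bsup>(p)\<^esup> \<inter> X\<^sub>k\<close>. There are \<open>s\<^sub>k + d - 1\<close> choose \<open>d - 1\<close> ways to cut that list. Two different
  members \<open>i\<close>, \<open>j\<close> whose events occur cannot be cut in the same way for all \<open>k \<noteq> l\<close>: let
  \<open>x \<in> A\<^sub>i\<^bsup>(p)\<^esup> \<inter> A\<^sub>j\<^bsup>(q)\<^esup>\<close> and \<open>y \<in> A\<^sub>j\<^bsup>(p)\<^esup> \<inter> A\<^sub>i\<^bsup>(q)\<^esup>\<close> with \<open>p < q\<close>. If \<open>x\<close> or \<open>y\<close> lay in \<open>S\<^sub>k\<close> with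
  \<open>k \<noteq> l\<close>, it would be in two intervals of the same cut (lemma \<open>no_crossing_if_cut_gaps_eq\<close>).
  So both lie in \<open>S\<^sub>l\<close>, where \<open>E\<^sub>i\<close> puts \<open>x\<close> before \<open>y\<close> and \<open>E\<^sub>j\<close> puts \<open>y\<close> before \<open>x\<close>
  (lemma \<open>no_double_crossing\<close>). Hence at most as many events occur as there are choices of
  cuts for all \<open>k \<noteq> l\<close> (lemma \<open>card_block_ordered_members_le\<close>).
\<close>

section \<open>Orders that list the blocks one after the other\<close>

text \<open>
  The relation constrains only pairs in which both elements lie in blocks; all other pairs are
  related, so elements outside of the blocks may stand anywhere in a block-ordered list.
\<close>

definition in_block_order :: "nat \<Rightarrow> (nat \<Rightarrow> 'a set) \<Rightarrow> 'a \<Rightarrow> 'a \<Rightarrow> bool" where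
  "in_block_order d a x y \<longleftrightarrow> (\<forall>p\<in>{1..d}. \<forall>q\<in>{1..d}. x \<in> a p \<longrightarrow> y \<in> a q \<longrightarrow> p \<le> q)"

lemma in_block_orderD:
  "in_block_order d a x y \<Longrightarrow> p \<in> {1..d} \<Longrightarrow> q \<in> {1..d} \<Longrightarrow> x \<in> a p \<Longrightarrow> y \<in> a q \<Longrightarrow> p \<le> q"
  unfolding in_block_order_def by blast

definition block_ordered :: "nat \<Rightarrow> (nat \<Rightarrow> 'a set) \<Rightarrow> 'a list \<Rightarrow> bool" where
  "block_ordered d a xs \<longleftrightarrow> sorted_wrt (in_block_order d a) xs"

text \<open>
  A list is sorted with respect to an arbitrary relation iff its head is related to all later
  elements and its tail is sorted, so the sorted arrangements can be counted by their first
  element. \<open>R\<close> need not be transitive, as \<open>in_block_order\<close> is not.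
\<close>

lemma card_sorted_wrt_permutations_rec:
  assumes "finite S" "S \<noteq> {}"
  shows "card {xs \<in> permutations_of_set S. sorted_wrt R xs} =
    (\<Sum>x \<in> {x \<in> S. \<forall>y \<in> S - {x}. R x y}. card {xs \<in> permutations_of_set (S - {x}). sorted_wrt R xs})"
proof -
  let ?F = "{x \<in> S. \<forall>y \<in> S - {x}. R x y}"
  let ?Q = "\<lambda>T. {xs \<in> permutations_of_set T. sorted_wrt R xs}"
  have "?Q S = {xs \<in> (\<Union>x\<in>S. (#) x ` permutations_of_set (S - {x})). sorted_wrt R xs}"
    by (simp only: permutations_of_set_nonempty[OF assms(2)])
  also have "\<dots> = (\<Union>x\<in>?F. (#) x ` ?Q (S - {x}))" (is "?L = ?R")
  proof (intro equalityI subsetI)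
    fix xs assume "xs \<in> ?L"
    then obtain x ys where x: "x \<in> S" "xs = x # ys" "ys \<in> permutations_of_set (S - {x})"
      and sorted: "sorted_wrt R (x # ys)" by blast
    from sorted x have "x \<in> ?F" "ys \<in> ?Q (S - {x})"
      using permutations_of_setD(1)[OF x(3)] by simp_all
    with x(2) show "xs \<in> ?R" by blast
  next
    fix xs assume "xs \<in> ?R"
    then obtain x ys where x: "x \<in> ?F" "xs = x # ys" "ys \<in> ?Q (S - {x})" by blast
    then have "sorted_wrt R xs" using permutations_of_setD(1)[of ys "S - {x}"] by simp
    with x show "xs \<in> ?L" by blast
  qed
  finally have "?Q S = (\<Union>x\<in>?F. (#) x ` ?Q (S - {x}))" .
  moreover have "card (\<Union>x\<in>?F. (#) x ` ?Q (S - {x})) = (\<Sum>x\<in>?F. card ((#) x ` ?Q (S - {x})))"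
    using assms by (intro card_UN_disjoint) auto
  moreover have "card ((#) x ` ?Q (S - {x})) = card (?Q (S - {x}))" for x
    by (intro card_image) auto
  ultimately show ?thesis by simp
qed

text \<open>
  A random order of \<open>S\<close> lists the blocks one after the other with probability equal to the
  inverse of a multinomial coefficient. The proof is by recursion on the first element of the
  order, which is either an element outside of all blocks or an element of the first block
  that meets \<open>S\<close>. With \<open>s = card S\<close>, \<open>w\<close> the number of elements of \<open>S\<close> in blocks, \<open>P\<close> the
  product of the factorials and \<open>c\<close> the size of that first block in \<open>S\<close>, each of the \<open>s - w\<close>
  outside elements contributes \<open>(s - 1)! * P\<close> to the count times \<open>w!\<close>, and each of the \<open>c\<close>
  elements of the block contributes \<open>w * (s - 1)! * P / c\<close>; the sum is \<open>s! * P\<close>.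
  The blocks may stick out of \<open>S\<close>, so that they stay the same when an element is removed
  from \<open>S\<close>.
\<close>

lemma card_block_ordered_permutations:
  assumes "finite S" "disjoint_family_on a {1..d}"
  shows "real (card {xs \<in> permutations_of_set S. block_ordered d a xs}) * fact (\<Sum>r=1..d. card (a r \<inter> S))
    = fact (card S) * (\<Prod>r=1..d. fact (card (a r \<inter> S)))"
  using assms(1)
proof (induction S rule: finite_psubset_induct)
  case (psubset S)
  let ?N = "\<lambda>T. real (card {xs \<in> permutations_of_set T. block_ordered d a xs})"
  define U where "U = (\<Union>r\<in>{1..d}. a r)"
  define w where "w T = (\<Sum>r=1..d. card (a r \<inter> T))" for T
  define P :: "'a set \<Rightarrow> real" where "P T = (\<Prod>r=1..d. fact (card (a r \<inter> T)))" for T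
  have IH: "?N (S - {x}) * fact (w (S - {x})) = fact (card S - 1) * P (S - {x})" if "x \<in> S" for x
    using psubset.IH[of "S - {x}"] that psubset.hyps by (auto simp: w_def P_def)
  have w_card: "w S = card (U \<inter> S)"
  proof -
    have "U \<inter> S = (\<Union>r\<in>{1..d}. a r \<inter> S)" by (auto simp: U_def)
    then show ?thesis unfolding w_def using psubset.hyps assms(2)
      by (simp only:) (subst card_UN_disjoint; auto simp: disjoint_family_on_def)
  qed
  show ?case
  proof (cases "S = {}")
    case True
    then show ?thesis by (simp add: block_ordered_def cong: conj_cong)
  next
    case False
    define s where "s = card S"
    have s0: "s > 0" using False psubset.hyps by (simp add: s_def card_gt_0_iff)
    let ?F = "{x \<in> S. \<forall>y \<in> S - {x}. in_block_order d a x y}"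
    have rec: "?N S = (\<Sum>x\<in>?F. ?N (S - {x}))"
      using card_sorted_wrt_permutations_rec[OF psubset.hyps(1) False, of "in_block_order d a"]
      by (simp add: block_ordered_def)
    have outside: "?N (S - {x}) * fact (w S) = fact (s - 1) * P S" if "x \<in> S - U" for x
    proof -
      have "a r \<inter> (S - {x}) = a r \<inter> S" if "r \<in> {1..d}" for r
        using that \<open>x \<in> S - U\<close> by (auto simp: U_def)
      then have "w (S - {x}) = w S" "P (S - {x}) = P S" by (auto simp: w_def P_def)
      then show ?thesis using IH[of x] that by (simp add: s_def)
    qed
    show ?thesis
    proof (cases "U \<inter> S = {}")
      case True
      have "?F = S" using True by (auto simp: U_def in_block_order_def)
      then have "?N S * fact (w S) = (\<Sum>x\<in>S. ?N (S - {x}) * fact (w S))"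
        by (simp add: rec sum_distrib_right)
      also have "\<dots> = (\<Sum>x\<in>S. fact (s - 1) * P S)"
        using True by (intro sum.cong outside) auto
      also have "\<dots> = fact s * P S" using s0 by (simp add: s_def fact_reduce)
      finally show ?thesis by (simp add: w_def P_def s_def)
    next
      case False
      define p where "p = (LEAST r. r \<in> {1..d} \<and> a r \<inter> S \<noteq> {})"
      have ex: "\<exists>r. r \<in> {1..d} \<and> a r \<inter> S \<noteq> {}" using False by (auto simp: U_def)
      have p: "p \<in> {1..d}" "a p \<inter> S \<noteq> {}" using LeastI_ex[OF ex] by (auto simp: p_def)
      have pmin: "p \<le> r" if "r \<in> {1..d}" "a r \<inter> S \<noteq> {}" for r
        unfolding p_def using that by (intro Least_le) auto
      have disj: "r = r'" if "x \<in> a r" "x \<in> a r'" "r \<in> {1..d}" "r' \<in> {1..d}" for x r r'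
        using disjoint_family_onD[OF assms(2), of r r'] that by blast
      \<comment> \<open>No element of a block later than \<open>p\<close> can come first, as \<open>a p \<inter> S\<close> is nonempty.\<close>
      have F: "?F = (S - U) \<union> (a p \<inter> S)"
      proof (intro equalityI subsetI)
        fix x assume x: "x \<in> ?F"
        obtain y where y: "y \<in> a p" "y \<in> S" using p by auto
        show "x \<in> (S - U) \<union> (a p \<inter> S)"
        proof (cases "x \<in> U")
          case True
          then obtain r where r: "r \<in> {1..d}" "x \<in> a r" by (auto simp: U_def)
          have "p \<le> r" using pmin r x by auto
          moreover have "r \<le> p"
          proof (cases "x = y")
            case True
            then show ?thesis using disj[of y r p] y r p by auto
          next
            case False
            then have "in_block_order d a x y" using x y by auto
            then show ?thesis by (rule in_block_orderD[OF _ r(1) p(1) r(2) y(1)])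
          qed
          ultimately show ?thesis using r x by auto
        qed (use x in auto)
      next
        fix x assume x: "x \<in> (S - U) \<union> (a p \<inter> S)"
        have "in_block_order d a x y" if y: "y \<in> S" for y
          unfolding in_block_order_def
        proof (intro ballI impI)
          fix r q assume rq: "r \<in> {1..d}" "q \<in> {1..d}" "x \<in> a r" "y \<in> a q"
          then have "x \<in> a p" using x by (auto simp: U_def)
          then have "r = p" using disj rq p by blast
          then show "r \<le> q" using pmin[of q] rq y by auto
        qed
        then show "x \<in> ?F" using x by auto
      qed
      define c where "c = card (a p \<inter> S)"
      have c0: "c > 0" using p psubset.hyps by (simp add: c_def card_gt_0_iff)
      have inside: "?N (S - {x}) * fact (w S) = w S * fact (s - 1) * P S / c" if x: "x \<in> a p \<inter> S" for x
      proof -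
        have other: "a r \<inter> (S - {x}) = a r \<inter> S" if "r \<in> {1..d} - {p}" for r
          using that x disj[of x r p] p by auto
        have own: "card (a p \<inter> (S - {x})) = c - 1"
        proof -
          have "a p \<inter> (S - {x}) = (a p \<inter> S) - {x}" by auto
          then show ?thesis using x psubset.hyps by (simp add: c_def)
        qed
        have "w S = c + (\<Sum>r\<in>{1..d}-{p}. card (a r \<inter> S))"
          unfolding w_def c_def using p by (subst sum.remove[of _ p]) auto
        moreover have "w (S - {x}) = (c - 1) + (\<Sum>r\<in>{1..d}-{p}. card (a r \<inter> S))"
          unfolding w_def using p own other by (subst sum.remove[of _ p]) auto
        ultimately have w1: "w S = Suc (w (S - {x}))" using c0 by simp
        have "P S = fact c * (\<Prod>r\<in>{1..d}-{p}. fact (card (a r \<inter> S)))"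
          unfolding P_def c_def using p by (subst prod.remove[of _ p]) auto
        moreover have "P (S - {x}) = fact (c - 1) * (\<Prod>r\<in>{1..d}-{p}. fact (card (a r \<inter> S)))"
          unfolding P_def using p own other by (subst prod.remove[of _ p]) auto
        ultimately have P1: "P S = c * P (S - {x})" using c0 by (simp add: fact_reduce)
        have "?N (S - {x}) * fact (w S) = w S * (?N (S - {x}) * fact (w (S - {x})))"
          by (simp add: w1)
        also have "\<dots> = w S * (fact (s - 1) * P (S - {x}))" using IH[of x] x by (simp add: s_def)
        also have "\<dots> = w S * fact (s - 1) * P S / c" using c0 by (simp add: P1)
        finally show ?thesis .
      qed
      have "?N S * fact (w S) = (\<Sum>x\<in>(S - U) \<union> (a p \<inter> S). ?N (S - {x}) * fact (w S))"
        unfolding rec F by (simp add: sum_distrib_right)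
      also have "\<dots> = (\<Sum>x\<in>S - U. ?N (S - {x}) * fact (w S)) + (\<Sum>x\<in>a p \<inter> S. ?N (S - {x}) * fact (w S))"
        using psubset.hyps p by (intro sum.union_disjoint) (auto simp: U_def)
      also have "\<dots> = card (S - U) * (fact (s - 1) * P S) + c * (w S * fact (s - 1) * P S / c)"
        by (simp add: outside inside c_def)
      also have "\<dots> = (real (card (S - U)) + w S) * (fact (s - 1) * P S)"
        using c0 by (simp add: algebra_simps)
      also have "real (card (S - U)) + w S = s"
      proof -
        have "card (S - U) + w S = s"
          using card_Int_Diff[OF psubset.hyps(1), of U] by (simp add: w_card s_def Int_commute)
        then show ?thesis by linarith
      qed
      also have "s * (fact (s - 1) * P S) = fact s * P S" using s0 by (simp add: fact_reduce)
      finally show ?thesis by (simp add: w_def P_def s_def)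
    qed
  qed
qed

section \<open>Cutting a list into intervals\<close>

text \<open>
  For \<open>r < d\<close> the value \<open>cut d a xs r\<close> is the length of the shortest prefix of \<open>xs\<close> that
  contains every element of \<open>xs\<close> from the blocks \<open>1, \<dots>, r\<close>. The \<open>p\<close>-th interval consists of the positions
  from \<open>cut d a xs (p - 1)\<close> up to, but excluding, \<open>cut d a xs p\<close>. The value for \<open>r \<ge> d\<close> makes the
  \<open>d\<close> intervals exhaust the list.
\<close>

definition cut :: "nat \<Rightarrow> (nat \<Rightarrow> 'a set) \<Rightarrow> 'a list \<Rightarrow> nat \<Rightarrow> nat" where
  "cut d a xs r = (if r < d
     then card {t. \<exists>u<length xs. t \<le> u \<and> (\<exists>p\<in>{1..r}. xs ! u \<in> a p)}
     else length xs)"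

text \<open>
  A cut is recorded by the lengths of its \<open>d\<close> intervals: such a list is a weak composition of
  \<open>length xs\<close> into \<open>d\<close> parts, and weak compositions are easy to count.
\<close>

definition cut_gaps :: "nat \<Rightarrow> (nat \<Rightarrow> 'a set) \<Rightarrow> 'a list \<Rightarrow> nat list" where
  "cut_gaps d a xs = map (\<lambda>r. cut d a xs (Suc r) - cut d a xs r) [0..<d]"

lemma cut_0: "d > 0 \<Longrightarrow> cut d a xs 0 = 0"
  by (simp add: cut_def)

lemma mono_cut: "mono (cut d a xs)"
proof (rule monoI)
  fix r r' :: nat assume "r \<le> r'"
  let ?D = "\<lambda>r. {t. \<exists>u<length xs. t \<le> u \<and> (\<exists>p\<in>{1..r}. xs ! u \<in> a p)}"
  have sub: "?D r \<subseteq> {..<length xs}" for r by auto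
  have "card (?D r) \<le> card (?D r')"
    using \<open>r \<le> r'\<close> by (intro card_mono finite_subset[OF sub]) force+
  moreover have "card (?D r) \<le> length xs"
    using card_mono[OF _ sub[of r]] by simp
  ultimately show "cut d a xs r \<le> cut d a xs r'"
    using \<open>r \<le> r'\<close> by (auto simp: cut_def)
qed

lemma sum_list_gaps:
  fixes f :: "nat \<Rightarrow> nat"
  assumes "mono f"
  shows "sum_list (map (\<lambda>r. f (Suc r) - f r) [0..<n]) = f n - f 0"
proof (induction n)
  case (Suc n)
  have "f 0 \<le> f n" "f n \<le> f (Suc n)" using assms by (auto intro: monoD)
  with Suc show ?case by simp
qed simp

lemma cut_gaps_composition:
  assumes "d > 0"
  shows "length (cut_gaps d a xs) = d" "sum_list (cut_gaps d a xs) = length xs"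
  using sum_list_gaps[OF mono_cut, of d a xs d] assms by (simp_all add: cut_gaps_def cut_def)

text \<open>The interval lengths determine the cut, so nothing is lost by recording only them.\<close>

lemma cut_eq_sum_take_gaps:
  assumes "r < d"
  shows "cut d a xs r = sum_list (take r (cut_gaps d a xs))"
  using sum_list_gaps[OF mono_cut, of d a xs r] assms
  by (simp add: cut_gaps_def take_map cut_0)

text \<open>
  In a block-ordered list the \<open>r\<close>-th cut separates the blocks up to \<open>r\<close> from the later ones:
  an element of a later block stands after all elements of the earlier blocks, so the shortest
  prefix containing these does not reach it.
\<close>

lemma less_cut_iff:
  assumes "block_ordered d a xs" "disjoint_family_on a {1..d}"
    and "t < length xs" "p \<in> {1..d}" "xs ! t \<in> a p" "r < d"
  shows "t < cut d a xs r \<longleftrightarrow> p \<le> r"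
proof -
  let ?D = "{t. \<exists>u<length xs. t \<le> u \<and> (\<exists>p\<in>{1..r}. xs ! u \<in> a p)}"
  have fin: "finite ?D" by (rule finite_subset[of _ "{..<length xs}"]) auto
  show ?thesis
  proof
    assume "p \<le> r"
    then have "p \<in> {1..r}" using assms by auto
    then have "{..t} \<subseteq> ?D" using assms(3,5) by blast
    \<comment> \<open>\<open>{..t}\<close> has \<open>Suc t\<close> elements.\<close>
    from card_mono[OF fin this] show "t < cut d a xs r" using assms by (simp add: cut_def)
  next
    assume less: "t < cut d a xs r"
    have "\<not> ?D \<subseteq> {..<t}"
      using card_mono[of "{..<t}" ?D] less assms by (auto simp: cut_def)
    then obtain v where v: "v \<in> ?D" "\<not> v < t" by blast
    then obtain u q where "v \<le> u" and u: "u < length xs" "q \<in> {1..r}" "xs ! u \<in> a q"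
      by blast
    then have "t \<le> u" using v by simp
    have q: "q \<in> {1..d}" using u assms by auto
    show "p \<le> r"
    proof (cases "t = u")
      case True
      then have "p = q" using disjoint_family_onD[OF assms(2), of p q] assms(4,5) u q by blast
      then show ?thesis using u by auto
    next
      case False
      then have "in_block_order d a (xs ! t) (xs ! u)"
        using assms(1) u \<open>t \<le> u\<close> by (auto simp: block_ordered_def sorted_wrt_iff_nth_less)
      then have "p \<le> q" by (rule in_block_orderD[OF _ assms(4) q assms(5) u(3)])
      then show ?thesis using u by auto
    qed
  qed
qed

section \<open>How many members can be block-ordered at once\<close>

text \<open>
  If the same cut serves two tuples of blocks, then the \<open>p\<close>-th cut puts \<open>x\<close> on its left as an
  element of \<open>a p\<close> and on its right as an element of \<open>b q\<close>.
\<close>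

lemma no_crossing_if_cut_gaps_eq:
  assumes "block_ordered d a xs" "disjoint_family_on a {1..d}"
    and "block_ordered d b xs" "disjoint_family_on b {1..d}"
    and gaps: "cut_gaps d a xs = cut_gaps d b xs"
    and x: "x \<in> set xs" "x \<in> a p" "x \<in> b q" and pq: "1 \<le> p" "p < q" "q \<le> d"
  shows False
proof -
  obtain t where t: "t < length xs" "xs ! t = x" using x by (auto simp: in_set_conv_nth)
  have "t < cut d a xs p" using less_cut_iff[OF assms(1,2) t(1), of p p] t x pq by auto
  moreover have "\<not> t < cut d b xs p" using less_cut_iff[OF assms(3,4) t(1), of q p] t x pq by auto
  ultimately show False using gaps pq by (simp add: cut_eq_sum_take_gaps)
qed

text \<open>
  This is the contradiction in the remaining part \<open>S\<^sub>l\<close>, which is not cut: \<open>a\<close> forces \<open>x\<close> before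
  \<open>y\<close>, whereas \<open>b\<close> forces \<open>y\<close> before \<open>x\<close>, and \<open>x = y\<close> would put one element in two blocks of \<open>a\<close>.
\<close>

lemma no_double_crossing:
  assumes "block_ordered d a xs" "disjoint_family_on a {1..d}" "block_ordered d b xs"
    and x: "x \<in> set xs" "x \<in> a p" "x \<in> b q"
    and y: "y \<in> set xs" "y \<in> b p" "y \<in> a q"
    and pq: "1 \<le> p" "p < q" "q \<le> d"
  shows False
proof -
  obtain t u where t: "t < length xs" "xs ! t = x" and u: "u < length xs" "xs ! u = y"
    using x y by (auto simp: in_set_conv_nth)
  have P: "p \<in> {1..d}" "q \<in> {1..d}" using pq by auto
  consider "t < u" | "u < t" | "t = u" by linarith
  then show False
  proof cases
    case 1
    then have "in_block_order d b x y" using assms(3) t u by (auto simp: block_ordered_def sorted_wrt_iff_nth_less)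
    from in_block_orderD[OF this P(2) P(1) x(3) y(2)] show False using pq by simp
  next
    case 2
    then have "in_block_order d a y x" using assms(1) t u by (auto simp: block_ordered_def sorted_wrt_iff_nth_less)
    from in_block_orderD[OF this P(2) P(1) y(3) x(2)] show False using pq by simp
  next
    case 3
    then have "x \<in> a p \<inter> a q" using t u x y by auto
    then show False using disjoint_family_onD[OF assms(2) P] pq by simp
  qed
qed

text \<open>
  For fixed orders \<open>\<sigma>\<close>, a block-ordered member is determined by its cuts of all lists but the
  \<open>l\<close>-th. One list can be left out because a crossing pair inside it already contradicts the
  order; this is why the final bound lacks the factor of \<open>l\<close>.
\<close>

lemma card_block_ordered_members_le:
  fixes A :: "nat \<Rightarrow> nat \<Rightarrow> nat set" and \<sigma> :: "nat \<Rightarrow> nat list"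
  assumes sys: "symmetric_bollobas_system d n m A" and "d > 0" and l: "l \<in> {1..e}"
    and cover: "\<And>i r. i \<in> {1..m} \<Longrightarrow> r \<in> {1..d} \<Longrightarrow> A i r \<subseteq> (\<Union>k\<in>{1..e}. set (\<sigma> k))"
  shows "card {i \<in> {1..m}. \<forall>k\<in>{1..e}. block_ordered d (A i) (\<sigma> k)}
    \<le> (\<Prod>k\<in>{1..e} - {l}. (length (\<sigma> k) + d - 1) choose (d - 1))"
proof -
  let ?G = "{i \<in> {1..m}. \<forall>k\<in>{1..e}. block_ordered d (A i) (\<sigma> k)}"
  let ?C = "\<lambda>k. {c :: nat list. length c = d \<and> sum_list c = length (\<sigma> k)}"
  define g where "g i = (\<lambda>k\<in>{1..e} - {l}. cut_gaps d (A i) (\<sigma> k))" for i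
  have cardC: "card (?C k) = (length (\<sigma> k) + d - 1) choose (d - 1)" for k
    using \<open>d > 0\<close> binomial_symmetric[of "length (\<sigma> k)" "length (\<sigma> k) + d - 1"]
    by (simp add: card_length_sum_list)
  have "finite (?C k)" for k
    using cardC[of k] \<open>d > 0\<close> by (intro card_ge_0_finite) simp
  then have fin: "finite (PiE ({1..e} - {l}) ?C)" by (intro finite_PiE) auto
  have disj: "disjoint_family_on (A i) {1..d}" if "i \<in> {1..m}" for i
    using sys that by (auto simp: symmetric_bollobas_system_def d_partition_def)
  \<comment> \<open>Ordering the indices matches the system's condition, which speaks only of \<open>i < j\<close>.\<close>
  have ne: "g i \<noteq> g j" if ij: "i \<in> ?G" "j \<in> ?G" "i < j" for i j
  proof
    assume eq: "g i = g j"
    have gaps: "cut_gaps d (A i) (\<sigma> k) = cut_gaps d (A j) (\<sigma> k)" if "k \<in> {1..e} - {l}" for k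
      using fun_cong[OF eq, of k] that by (simp add: g_def)
    have mem: "i \<in> {1..m}" "j \<in> {1..m}" using ij by auto
    have ord: "block_ordered d (A i) (\<sigma> k)" "block_ordered d (A j) (\<sigma> k)" if "k \<in> {1..e}" for k
      using ij that by auto
    have "1 \<le> i \<and> i < j \<and> j \<le> m" using ij by auto
    then obtain p q x y where pq: "1 \<le> p" "p < q" "q \<le> d" and x: "x \<in> A i p" "x \<in> A j q"
      and y: "y \<in> A j p" "y \<in> A i q"
      using sys unfolding symmetric_bollobas_system_def by blast
    have P: "p \<in> {1..d}" using pq by auto
    have "x \<in> set (\<sigma> l)"
    proof -
      obtain k where k: "k \<in> {1..e}" "x \<in> set (\<sigma> k)" using cover[OF mem(1) P] x by blast
      have "k = l"
        using no_crossing_if_cut_gaps_eq[OF ord(1)[OF k(1)] disj[OF mem(1)] ord(2)[OF k(1)]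
            disj[OF mem(2)] gaps k(2) x pq] k(1) by blast
      with k show ?thesis by simp
    qed
    moreover have "y \<in> set (\<sigma> l)"
    proof -
      obtain k where k: "k \<in> {1..e}" "y \<in> set (\<sigma> k)" using cover[OF mem(2) P] y by blast
      have "k = l"
        using no_crossing_if_cut_gaps_eq[OF ord(2)[OF k(1)] disj[OF mem(2)] ord(1)[OF k(1)]
            disj[OF mem(1)] gaps[symmetric] k(2) y pq] k(1) by blast
      with k show ?thesis by simp
    qed
    ultimately show False
      using no_double_crossing[OF ord(1)[OF l] disj[OF mem(1)] ord(2)[OF l] _ x _ y pq] by blast
  qed
  have "inj_on g ?G"
  proof (rule inj_onI)
    fix i j assume "i \<in> ?G" "j \<in> ?G" "g i = g j"
    then show "i = j" using ne[of i j] ne[of j i] by (cases i j rule: linorder_cases) simp_all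
  qed
  moreover have "g ` ?G \<subseteq> PiE ({1..e} - {l}) ?C"
    using \<open>d > 0\<close> by (intro image_subsetI) (simp add: g_def restrict_PiE_iff cut_gaps_composition)
  ultimately have "card ?G \<le> card (PiE ({1..e} - {l}) ?C)"
    using fin by (rule card_inj_on_le)
  also have "\<dots> = (\<Prod>k\<in>{1..e} - {l}. (length (\<sigma> k) + d - 1) choose (d - 1))"
    by (simp only: card_PiE finite_Diff finite_atLeastAtMost cardC)
  finally show ?thesis .
qed

section \<open>Averaging over all orders\<close>

theorem theorem1p12:
  fixes d e n m :: nat
    and X :: "nat \<Rightarrow> nat set"
    and A :: "nat \<Rightarrow> nat \<Rightarrow> nat set"
    and s :: "nat \<Rightarrow> nat"
  assumes "d \<ge> 2" and "e \<ge> 1" and "n \<ge> 1"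
    and "disjoint_family_on X {1..e}"
    and "(\<Union>k\<in>{1..e}. X k) = {1..n}"
    and "symmetric_bollobas_system d n m A"
    and "\<And>k. k \<in> {1..e} \<Longrightarrow> s k = card (X k \<inter> (\<Union>i\<in>{1..m}. \<Union>r\<in>{1..d}. A i r))"
  shows "(\<Sum>i=1..m. inverse (\<Prod>k=1..e.
             multinomial d (\<Sum>r=1..d. card (A i r \<inter> X k)) (\<lambda>r. card (A i r \<inter> X k))))
         \<le> (MIN l\<in>{1..e}.
              (\<Prod>k=1..e. real ((s k + d - 1) choose (d - 1)))
                / real ((s l + d - 1) choose (d - 1)))"
proof -
  define S where "S k = X k \<inter> (\<Union>i\<in>{1..m}. \<Union>r\<in>{1..d}. A i r)" for k
  define \<Omega> where "\<Omega> = PiE {1..e} (\<lambda>k. permutations_of_set (S k))"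
  define E where "E i \<sigma> \<longleftrightarrow> (\<forall>k\<in>{1..e}. block_ordered d (A i) (\<sigma> k))" for i \<sigma>
  let ?M = "\<lambda>i. \<Prod>k=1..e. multinomial d (\<Sum>r=1..d. card (A i r \<inter> X k)) (\<lambda>r. card (A i r \<inter> X k))"
  let ?b = "\<lambda>k. (s k + d - 1) choose (d - 1)"
  have finS: "finite (S k)" if "k \<in> {1..e}" for k
  proof -
    have "X k \<subseteq> {1..n}" using assms(5) that by auto
    then show ?thesis unfolding S_def by (auto intro: finite_subset)
  qed
  have sS: "s k = card (S k)" if "k \<in> {1..e}" for k using assms(7) that by (simp add: S_def)
  have disj: "disjoint_family_on (A i) {1..d}" and sub: "\<And>r. r \<in> {1..d} \<Longrightarrow> A i r \<subseteq> {1..n}"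
    if "i \<in> {1..m}" for i
    using assms(6) that by (auto simp: symmetric_bollobas_system_def d_partition_def)
  have fin\<Omega>: "finite \<Omega>" unfolding \<Omega>_def by (intro finite_PiE) auto
  have card\<Omega>: "card \<Omega> = (\<Prod>k=1..e. fact (s k))"
    unfolding \<Omega>_def by (simp add: card_PiE finS sS)
  \<comment> \<open>The probability of \<open>E i\<close>, a product since \<open>E i\<close> constrains each order separately.\<close>
  have event: "real (card {\<sigma>\<in>\<Omega>. E i \<sigma>}) = card \<Omega> * inverse (?M i)" if i: "i \<in> {1..m}" for i
  proof -
    let ?Q = "\<lambda>k. {xs \<in> permutations_of_set (S k). block_ordered d (A i) xs}"
    have "{\<sigma>\<in>\<Omega>. E i \<sigma>} = PiE {1..e} ?Q"
      unfolding \<Omega>_def E_def by (rule set_eqI) (simp add: PiE_iff, blast)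
    then have "real (card {\<sigma>\<in>\<Omega>. E i \<sigma>}) = (\<Prod>k=1..e. real (card (?Q k)))"
      by (simp add: card_PiE)
    also have "\<dots> = (\<Prod>k=1..e. fact (s k) * inverse
        (multinomial d (\<Sum>r=1..d. card (A i r \<inter> X k)) (\<lambda>r. card (A i r \<inter> X k))))"
    proof (rule prod.cong)
      fix k assume k: "k \<in> {1..e}"
      have restrict: "A i r \<inter> S k = A i r \<inter> X k" if "r \<in> {1..d}" for r
        using that i unfolding S_def by blast
      have "real (card (?Q k)) * fact (\<Sum>r=1..d. card (A i r \<inter> X k))
          = fact (s k) * (\<Prod>r=1..d. fact (card (A i r \<inter> X k)))"
        using card_block_ordered_permutations[OF finS[OF k] disj[OF i]] restrict
        by (simp add: sS[OF k])
      then show "real (card (?Q k)) = fact (s k) * inverse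
        (multinomial d (\<Sum>r=1..d. card (A i r \<inter> X k)) (\<lambda>r. card (A i r \<inter> X k)))"
        by (simp add: multinomial_def field_simps)
    qed simp
    also have "\<dots> = card \<Omega> * inverse (?M i)"
      by (simp add: prod.distrib card\<Omega> prod_inversef[symmetric] o_def)
    finally show ?thesis .
  qed
  have bound: "(\<Sum>i=1..m. inverse (?M i)) \<le> (\<Prod>k=1..e. real (?b k)) / real (?b l)"
    if l: "l \<in> {1..e}" for l
  proof -
    have fibre: "card {i \<in> {1..m}. E i \<sigma>} \<le> (\<Prod>k\<in>{1..e} - {l}. ?b k)" if \<sigma>: "\<sigma> \<in> \<Omega>" for \<sigma>
    proof -
      have perm: "set (\<sigma> k) = S k" "length (\<sigma> k) = s k" if "k \<in> {1..e}" for k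
        using \<sigma> that sS[OF that]
        by (auto simp: \<Omega>_def PiE_iff permutations_of_setD length_finite_permutations_of_set)
      have "A i r \<subseteq> (\<Union>k\<in>{1..e}. set (\<sigma> k))" if ir: "i \<in> {1..m}" "r \<in> {1..d}" for i r
      proof
        fix x assume x: "x \<in> A i r"
        then obtain k where "k \<in> {1..e}" "x \<in> X k" using sub[OF ir] assms(5) by blast
        then show "x \<in> (\<Union>k\<in>{1..e}. set (\<sigma> k))" using x ir perm(1) unfolding S_def by blast
      qed
      from card_block_ordered_members_le[OF assms(6) _ l this] assms(1)
      have "card {i \<in> {1..m}. E i \<sigma>} \<le> (\<Prod>k\<in>{1..e} - {l}. (length (\<sigma> k) + d - 1) choose (d - 1))"
        by (simp add: E_def)
      also have "\<dots> = (\<Prod>k\<in>{1..e} - {l}. ?b k)" using perm by (intro prod.cong) auto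
      finally show ?thesis .
    qed
    \<comment> \<open>Double counting of the pairs \<open>(i, \<sigma>)\<close> for which \<open>E i\<close> occurs at the outcome \<open>\<sigma>\<close>.\<close>
    have "card \<Omega> * (\<Sum>i=1..m. inverse (?M i)) = (\<Sum>i=1..m. real (card {\<sigma>\<in>\<Omega>. E i \<sigma>}))"
      unfolding sum_distrib_left by (intro sum.cong) (simp_all add: event)
    also have "\<dots> = real (\<Sum>\<sigma>\<in>\<Omega>. card {i \<in> {1..m}. E i \<sigma>})"
      unfolding of_nat_sum[symmetric] by (subst sum_multicount_gen[OF _ fin\<Omega>]) auto
    also have "(\<Sum>\<sigma>\<in>\<Omega>. card {i \<in> {1..m}. E i \<sigma>}) \<le> card \<Omega> * (\<Prod>k\<in>{1..e} - {l}. ?b k)"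
      using sum_bounded_above[of \<Omega>, OF fibre] by simp
    also have "real (card \<Omega> * (\<Prod>k\<in>{1..e} - {l}. ?b k)) = card \<Omega> * (\<Prod>k\<in>{1..e} - {l}. real (?b k))"
      by simp
    finally have "(\<Sum>i=1..m. inverse (?M i)) \<le> (\<Prod>k\<in>{1..e} - {l}. real (?b k))"
      by (simp add: card\<Omega> prod_pos)
    also have "\<dots> = (\<Prod>k=1..e. real (?b k)) / real (?b l)"
      using l prod.remove[of "{1..e}" l "\<lambda>k. real (?b k)"] by simp
    finally show ?thesis .
  qed
  show ?thesis
    using assms(2) bound by (subst Min_ge_iff) auto
qed

end
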